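(* Fix $j\in\mathbb N$ and write $\phi=\phi_j$, $\lambda=\lambda_j$. The function $x\mapsto x^{-1}\phi(x)$ is Lebesgue integrable on $[0,1]$; put $\Phi_1=\int_0^1\frac{\phi(y)}{y}\,dy\in\mathbb R$. If $0<x<1$ and $1/x$ is not an integer, then $\phi$ is differentiable at $x$ and $$\lambda^{-1}x^2\phi'(x)=\Phi_1-\sum_{m>1/x}\frac{\phi\left(\frac{1}{mx}\right)}{m}\in\mathbb R,$$ the sum being over integers $m>1/x$. Moreover, for each $n\in\mathbb N$, the derivative $\phi'$ is continuous on the open interval $\left(\frac1{n+1},\frac1n\right)$, and $$\lim_{x\to\frac1n-}\phi'(x)=\lambda n^2\Big(\Phi_1-\sum_{m=n+1}^\infty\frac{\phi(n/m)}{m}\Big)\in\mathbb R,\qquad \lim_{x\to\frac1{n+1}+}\phi'(x)=\lambda (n+1)^2\Big(\Phi_1-\sum_{m=n+1}^\infty\frac{\phi((n+1)/m)}{m}\Big)\in\mathbb R.$$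
   Context: Let $K:[0,1]\times[0,1]\to\mathbb R$ be defined by $K(x,y)=\frac12-\{(xy)^{-1}\}$ if $0<x,y\le 1$, and $K(x,y)=0$ if $0\le x,y\le1$ and $xy=0$, where $\{\alpha\}=\alpha-\lfloor\alpha\rfloor$. Let $L^2([0,1])$ denote the space of real-valued Lebesgue measurable square-integrable functions on $[0,1]$, with $\langle f,g\rangle=\int_0^1 f(x)g(x)\,dx$ and $\|f\|=\langle f,f\rangle^{1/2}$. A function $\phi$ is an eigenfunction of $K$ (with eigenvalue $\lambda\in\mathbb R$) if $\phi\in L^2([0,1])$, $\|\phi\|>0$, and $\phi(x)=\lambda\int_0^1 K(x,y)\phi(y)\,dy$ for every $x\in[0,1]$. Let $\phi_1,\phi_2,\ldots$ be a maximal orthonormal system in $L^2([0,1])$ of eigenfunctions of $K$, $\phi_j$ having the nonzero real eigenvalue $\lambda_j$, numbered so that $0<|\lambda_1|\le|\lambda_2|\le\cdots$ and $\lambda_j\ge\lambda_{j+1}$ whenever $|\lambda_j|=|\lambda_{j+1}|$. *)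

theory Defs
  imports "HOL-Analysis.Analysis"
begin

definition kerK :: "real \<Rightarrow> real \<Rightarrow> real" where
  "kerK x y = (if x * y = 0 then 0 else 1/2 - frac (1 / (x * y)))"

definition L2 :: "(real \<Rightarrow> real) \<Rightarrow> bool" where
  "L2 f \<longleftrightarrow> set_borel_measurable lebesgue {0..1} f
            \<and> set_integrable lebesgue {0..1} (\<lambda>x. (f x)\<^sup>2)"

definition inner01 :: "(real \<Rightarrow> real) \<Rightarrow> (real \<Rightarrow> real) \<Rightarrow> real" where
  "inner01 f g = (LINT x:{0..1}|lebesgue. f x * g x)"

definition norm01 :: "(real \<Rightarrow> real) \<Rightarrow> real" where
  "norm01 f = sqrt (inner01 f f)"

definition eigenfun :: "(real \<Rightarrow> real) \<Rightarrow> real \<Rightarrow> bool" where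
  "eigenfun phi lam \<longleftrightarrow> L2 phi \<and> norm01 phi > 0 \<and>
     (\<forall>x\<in>{0..1}. phi x = lam * (LINT y:{0..1}|lebesgue. kerK x y * phi y))"

definition eigen_system :: "(nat \<Rightarrow> real \<Rightarrow> real) \<Rightarrow> (nat \<Rightarrow> real) \<Rightarrow> bool" where
  "eigen_system phi lam \<longleftrightarrow>
     (\<forall>j\<ge>1. lam j \<noteq> 0 \<and> eigenfun (phi j) (lam j)) \<and>
     (\<forall>i\<ge>1. \<forall>k\<ge>1. inner01 (phi i) (phi k) = (if i = k then 1 else 0)) \<and>
     (\<forall>psi mu. eigenfun psi mu \<and> mu \<noteq> 0 \<longrightarrow> (\<exists>i\<ge>1. inner01 psi (phi i) \<noteq> 0)) \<and>
     (\<forall>j\<ge>1. 0 < \<bar>lam j\<bar> \<and> \<bar>lam j\<bar> \<le> \<bar>lam (Suc j)\<bar>) \<and>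
     (\<forall>j\<ge>1. \<bar>lam j\<bar> = \<bar>lam (Suc j)\<bar> \<longrightarrow> lam j \<ge> lam (Suc j))"

end

theory Submission
  imports Defs
begin

text \<open>
  The kernel oscillates with mean zero in its second variable, so integrating against the primitive
  of the sawtooth shows that the iterated kernel is \<open>O(sqrt (x / y))\<close>. Applying the eigenvalue
  equation twice gives \<open>\<phi>(x) = O(sqrt x)\<close>, whence \<open>\<phi>(y) / y\<close> is integrable and all series in the
  theorem converge uniformly. With \<open>\<Psi>(t) = \<integral>\<^sub>0\<^sup>t \<phi>\<close>, writing the floor in the kernel as a sum of
  indicator functions yields
  \<open>\<phi>(x) / \<lambda> = \<Psi>(1) / 2 - \<Phi>\<^sub>1 / x + \<Sum>m\<ge>1. \<Psi>(min 1 (1 / (m x)))\<close>,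
  which is differentiated term by term on each interval \<open>(1 / (n + 1), 1 / n)\<close>.
\<close>

section \<open>The sawtooth and the iterated kernel\<close>

text \<open>The sawtooth \<open>1/2 - frac t\<close> has mean zero over a period, so its primitives
  are periodic and bounded; this is the one vanishing at the integers. Up to an additive constant
  and the factor -1/2 it is the periodic Bernoulli function of degree two.\<close>

definition saw_primitive :: "real \<Rightarrow> real" where
  "saw_primitive t = (frac t - (frac t)\<^sup>2) / 2"

lemma saw_primitive_bounds: "0 \<le> saw_primitive t" "saw_primitive t \<le> 1/8"
proof -
  have "(frac t)\<^sup>2 \<le> frac t"
    using frac_lt_1[of t] by (simp add: power2_eq_square mult_left_le)
  then show "0 \<le> saw_primitive t"
    by (simp add: saw_primitive_def)
  have "0 \<le> (frac t - 1/2)\<^sup>2"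
    by simp
  then show "saw_primitive t \<le> 1/8"
    by (simp add: saw_primitive_def power2_eq_square algebra_simps)
qed

text \<open>Around an integer both one-sided branches of the primitive agree with one even function
  of the distance to that integer, which gives continuity at the jumps of the fractional part.\<close>

lemma saw_primitive_eq:
  assumes "\<bar>t - of_int n\<bar> < 1"
  shows "saw_primitive t = (\<bar>t - of_int n\<bar> - \<bar>t - of_int n\<bar>\<^sup>2) / 2"
proof (cases "t \<ge> of_int n")
  case True
  then have "frac t = t - of_int n"
    using assms by (subst frac_unique_iff) auto
  with True show ?thesis
    by (simp add: saw_primitive_def)
next
  case False
  then have "frac t = t - of_int n + 1"
    using assms by (subst frac_unique_iff) (auto simp: algebra_simps)
  moreover have "\<bar>t - of_int n\<bar> = of_int n - t"
    using False by simp
  ultimately show ?thesis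
    unfolding saw_primitive_def by (simp only:) (simp add: power2_eq_square algebra_simps)
qed

lemma isCont_saw_primitive: "isCont saw_primitive t"
proof -
  define n where "n = \<lfloor>t\<rfloor>"
  have "isCont (\<lambda>t::real. (\<bar>t - of_int n\<bar> - \<bar>t - of_int n\<bar>\<^sup>2) / 2) t"
    by (intro continuous_intros) auto
  moreover have "\<forall>\<^sub>F s in nhds t. (\<bar>s - of_int n\<bar> - \<bar>s - of_int n\<bar>\<^sup>2) / 2 = saw_primitive s"
  proof (rule eventually_nhds_in_open[THEN eventually_mono])
    show "open {of_int n - 1<..<of_int n + (1::real)}" by simp
    show "t \<in> {of_int n - 1<..<of_int n + (1::real)}"
      unfolding n_def by (auto; linarith)
    show "(\<bar>s - of_int n\<bar> - \<bar>s - of_int n\<bar>\<^sup>2) / 2 = saw_primitive s"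
      if "s \<in> {of_int n - 1<..<of_int n + (1::real)}" for s
      using that by (subst saw_primitive_eq[of s n]) (auto simp: abs_less_iff)
  qed
  ultimately show ?thesis
    by (rule isCont_cong[THEN iffD1, rotated])
qed

lemma saw_primitive_has_real_derivative:
  assumes "t \<notin> \<int>"
  shows "(saw_primitive has_real_derivative 1/2 - frac t) (at t)"
proof -
  define n where "n = \<lfloor>t\<rfloor>"
  have t: "of_int n < t" "t < of_int n + 1"
    using assms unfolding n_def by (metis Ints_of_int floor_correct less_le, linarith)
  have "((\<lambda>s. ((s - of_int n) - (s - of_int n)\<^sup>2) / 2) has_real_derivative 1/2 - frac t) (at t)"
    by (auto intro!: derivative_eq_intros simp: frac_def n_def field_simps)
  then show ?thesis
  proof (rule has_field_derivative_transform_within_open)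
    show "open {of_int n<..<of_int n + (1::real)}" by simp
    show "t \<in> {of_int n<..<of_int n + (1::real)}" using t by simp
    show "(s - of_int n - (s - of_int n)\<^sup>2) / 2 = saw_primitive s"
      if "s \<in> {of_int n<..<of_int n + (1::real)}" for s
      using that by (subst saw_primitive_eq[of _ n]) auto
  qed
qed

text \<open>These are the jumps of \<open>kerK x\<close> to the right of \<open>a\<close>, the
  exceptional points for the fundamental theorem of calculus. Keeping away from the origin bounds
  the integer \<open>1 / (x * z)\<close>. The index 0 only adds the harmless point
  \<open>1 / 0 = 0\<close> to the covering set.\<close>

lemma finite_reciprocal_Ints:
  assumes "0 < x" "0 < a"
  shows "finite {z::real. a \<le> z \<and> 1 / (x * z) \<in> \<int>}"
proof (rule finite_subset)
  show "{z. a \<le> z \<and> 1 / (x * z) \<in> \<int>} \<subseteq> (\<lambda>i::int. 1 / (x * of_int i)) ` {0..\<lfloor>1 / (x * a)\<rfloor>}"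
  proof clarify
    fix z assume z: "a \<le> z" "1 / (x * z) \<in> \<int>"
    then obtain i where i: "1 / (x * z) = of_int i"
      by (auto elim: Ints_cases)
    have "1 / (x * z) \<le> 1 / (x * a)"
      using assms z by (intro divide_left_mono mult_left_mono) auto
    then have "i \<le> \<lfloor>1 / (x * a)\<rfloor>"
      using i by (simp add: le_floor_iff)
    moreover have "(0::real) \<le> of_int i"
      unfolding i[symmetric] using assms z by simp
    ultimately have "i \<in> {0..\<lfloor>1 / (x * a)\<rfloor>}"
      by simp
    moreover have "z = 1 / (x * of_int i)"
      unfolding i[symmetric] using assms z by simp
    ultimately show "z \<in> (\<lambda>i::int. 1 / (x * of_int i)) ` {0..\<lfloor>1 / (x * a)\<rfloor>}"
      by blast
  qed
qed simp

section \<open>Oscillatory integrals of the kernel and its iterate\<close>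

lemma kerK_abs_le: "\<bar>kerK x y\<bar> \<le> 1/2"
  using frac_lt_1[of "1 / (x * y)"] frac_ge_0[of "1 / (x * y)"] 
  unfolding kerK_def by (simp only: abs_le_iff split: if_split) linarith

lemma borel_measurable_kerK [measurable (raw)]:
  assumes [measurable]: "f \<in> borel_measurable M" "g \<in> borel_measurable M"
  shows "(\<lambda>x. kerK (f x) (g x)) \<in> borel_measurable M"
  unfolding kerK_def frac_def by measurable

text \<open>With \<open>p z = saw_primitive (1 / (x * z))\<close> one has
  \<open>kerK x z = - x * z\<^sup>2 * p' z\<close> off the jumps. Integration by parts then leaves
  only terms carrying a factor \<open>x\<close> times the bounded function \<open>p\<close>. The
  resulting bound is uniform in the interval, and the constant 1 is generous.\<close>

lemma kerK_integral_bounds: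
  assumes x: "0 < x" and ab: "0 < a" "a \<le> b" "b \<le> 1"
  shows "kerK x integrable_on {a..b}" "\<bar>integral {a..b} (kerK x)\<bar> \<le> x"
    and "(\<lambda>z. kerK x z / z) integrable_on {a..b}" "\<bar>integral {a..b} (\<lambda>z. kerK x z / z)\<bar> \<le> x"
proof -
  define p where "p z = saw_primitive (1 / (x * z))" for z
  have p: "0 \<le> p z" "p z \<le> 1/8" for z
    unfolding p_def by (rule saw_primitive_bounds)+
  have contp: "continuous_on {a..b} p"
    unfolding p_def
    by (rule continuous_on_compose2[of UNIV saw_primitive])
       (use x ab in \<open>auto intro!: continuous_intros simp: continuous_on_eq_continuous_at isCont_saw_primitive\<close>)
  have derp: "(p has_real_derivative - (kerK x z / (x * z\<^sup>2))) (at z)"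
    if "a \<le> z" "1 / (x * z) \<notin> \<int>" for z
  proof -
    have "z > 0" using that ab by simp
    have "((\<lambda>z. 1 / (x * z)) has_real_derivative - (1 / (x * z\<^sup>2))) (at z)"
      using x \<open>z > 0\<close> by (auto intro!: derivative_eq_intros simp: field_simps power2_eq_square)
    from DERIV_chain2[OF saw_primitive_has_real_derivative[OF that(2)] this]
    show ?thesis
      using x \<open>z > 0\<close> by (simp add: p_def[abs_def] kerK_def)
  qed
  have fin: "finite {z. a \<le> z \<and> 1 / (x * z) \<in> \<int>}"
    using finite_reciprocal_Ints x ab by blast
  \<comment> \<open>This form allows finitely many interior points without a derivative, provided
    the antiderivative is continuous up to the ends; that is why continuity of \<open>p\<close>
    across the jumps matters.\<close>
  note FTC = fundamental_theorem_of_calculus_interior_strong[OF fin ab(2)]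

  have i2: "((\<lambda>z. 2 * z * x * p z - kerK x z) has_integral b\<^sup>2 * x * p b - a\<^sup>2 * x * p a) {a..b}"
  proof (rule FTC)
    fix z assume z: "z \<in> {a<..<b} - {z. a \<le> z \<and> 1 / (x * z) \<in> \<int>}"
    then have "((\<lambda>z. z\<^sup>2 * x * p z) has_real_derivative 2 * z * x * p z - kerK x z) (at z)"
      using x ab by (auto intro!: derivative_eq_intros derp simp: power2_eq_square field_simps)
    then show "((\<lambda>z. z\<^sup>2 * x * p z) has_vector_derivative 2 * z * x * p z - kerK x z) (at z)"
      by (simp add: has_real_derivative_iff_has_vector_derivative)
  qed (intro continuous_intros contp)
  have i1: "((\<lambda>z. 2 * z * x * p z) has_integral integral {a..b} (\<lambda>z. 2 * z * x * p z)) {a..b}"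
    by (intro integrable_integral integrable_continuous_real continuous_intros contp)
  have k: "(kerK x has_integral integral {a..b} (\<lambda>z. 2 * z * x * p z)
      - (b\<^sup>2 * x * p b - a\<^sup>2 * x * p a)) {a..b}"
    using has_integral_diff[OF i1 i2] by simp
  then show "kerK x integrable_on {a..b}" by blast
  have c: "0 \<le> c * x * p z \<and> c * x * p z \<le> x / 8" if "0 \<le> c" "c \<le> 1" for c z
  proof -
    have "c * p z \<le> 1 * (1/8)" "0 \<le> c * p z"
      using p[of z] that by (intro mult_mono mult_nonneg_nonneg; simp)+
    then show ?thesis
      using x mult_left_mono[of "c * p z" "1/8" x] mult_nonneg_nonneg[of x "c * p z"]
      by (simp add: ac_simps)
  qed
  have bd: "norm (integral {a..b} (\<lambda>z. 2 * z * x * p z)) \<le> x / 4 * (b - a)"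
  proof (rule integral_bound)
    show "norm (2 * z * x * p z) \<le> x / 4" if "z \<in> {a..b}" for z
      using c[of z z] that ab by auto
  qed (use ab in \<open>auto intro!: continuous_intros contp\<close>)
  have ba: "x / 4 * (b - a) \<le> x / 4" "x / 8 * (b - a) \<le> x / 8"
    using ab x by (auto simp: mult_left_le)
  have sq: "b\<^sup>2 \<le> 1" "a\<^sup>2 \<le> 1"
    using ab by (auto simp: power_le_one)
  show "\<bar>integral {a..b} (kerK x)\<bar> \<le> x"
    using integral_unique[OF k] bd ba c[of "b\<^sup>2" b] c[of "a\<^sup>2" a] sq by auto

  \<comment> \<open>The weight \<open>1 / z\<close> lowers the power of \<open>z\<close> in the
    antiderivative by one; the rest of the argument is repeated.\<close>
  have i2: "((\<lambda>z. x * p z - kerK x z / z) has_integral b * x * p b - a * x * p a) {a..b}"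
  proof (rule FTC)
    fix z assume z: "z \<in> {a<..<b} - {z. a \<le> z \<and> 1 / (x * z) \<in> \<int>}"
    then have "((\<lambda>z. z * x * p z) has_real_derivative x * p z - kerK x z / z) (at z)"
      using x ab by (auto intro!: derivative_eq_intros derp simp: power2_eq_square field_simps)
    then show "((\<lambda>z. z * x * p z) has_vector_derivative x * p z - kerK x z / z) (at z)"
      by (simp add: has_real_derivative_iff_has_vector_derivative)
  qed (intro continuous_intros contp)
  have i1: "((\<lambda>z. x * p z) has_integral integral {a..b} (\<lambda>z. x * p z)) {a..b}"
    by (intro integrable_integral integrable_continuous_real continuous_intros contp)
  have k: "((\<lambda>z. kerK x z / z) has_integral integral {a..b} (\<lambda>z. x * p z)
      - (b * x * p b - a * x * p a)) {a..b}"
    using has_integral_diff[OF i1 i2] by simp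
  then show "(\<lambda>z. kerK x z / z) integrable_on {a..b}" by blast
  have bd: "norm (integral {a..b} (\<lambda>z. x * p z)) \<le> x / 8 * (b - a)"
  proof (rule integral_bound)
    show "norm (x * p z) \<le> x / 8" if "z \<in> {a..b}" for z
      using c[of 1 z] x by auto
  qed (use ab in \<open>auto intro!: continuous_intros contp\<close>)
  show "\<bar>integral {a..b} (\<lambda>z. kerK x z / z)\<bar> \<le> x"
    using integral_unique[OF k] bd ba c[of b b] c[of a a] ab by auto
qed

text \<open>Turns the floor inside the kernel into indicators of intervals ending at
  \<open>1 / (k * y)\<close>. It is used with one fixed \<open>N\<close> for the iterated kernel and
  with growing \<open>N\<close> for the expansion of the eigenfunction.\<close>

lemma floor_eq_sum_indicator:
  assumes "0 \<le> t" "t < real N + 1"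
  shows "(\<Sum>k=1..N. if real k \<le> t then 1 else 0) = (of_int \<lfloor>t\<rfloor> :: real)"
proof -
  have "{k\<in>{1..N}. real k \<le> t} = {1..nat \<lfloor>t\<rfloor>}"
    using assms by (auto simp: le_nat_iff le_floor_iff nat_le_iff)
  moreover have "(\<Sum>k=1..N. if real k \<le> t then 1 else 0) = real (card {k\<in>{1..N}. real k \<le> t})"
    by (simp flip: sum.inter_filter)
  ultimately show ?thesis
    using assms by simp
qed

text \<open>The bound does not depend on \<open>N\<close>, which is what dominated convergence asks
  for.\<close>

lemma sum_indicator_le:
  assumes "0 \<le> t"
  shows "(\<Sum>k=1..N. if real k \<le> t then 1 else 0) \<le> (t :: real)"
proof -
  have "(\<Sum>k=1..N. if real k \<le> t then 1 else 0) = real (card {k\<in>{1..N}. real k \<le> t})"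
    by (simp flip: sum.inter_filter)
  also have "\<dots> \<le> real (card {1..nat \<lfloor>t\<rfloor>})"
    by (intro of_nat_mono card_mono) (auto simp: le_nat_iff le_floor_iff)
  also have "\<dots> \<le> t"
    using assms by simp
  finally show ?thesis .
qed

text \<open>For \<open>z \<ge> d\<close> the floor in \<open>kerK z y\<close> counts at most
  \<open>1 / (y * d)\<close> indicators, and each contributes an integral of \<open>kerK x\<close>
  over an interval, hence at most \<open>x\<close>. The three parts 1/2, \<open>1 / (z * y)\<close>
  and floor of the second kernel contribute 1/2, 1 and 1 to the constant 5/2.\<close>

lemma kerK_iterate_tail_bound:
  assumes x: "0 < x" and y: "0 < y" "y \<le> 1" and d: "0 < d" "d \<le> 1"
  shows "(\<lambda>z. kerK x z * kerK z y) integrable_on {d..1}"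
    and "\<bar>integral {d..1} (\<lambda>z. kerK x z * kerK z y)\<bar> \<le> 5/2 * (x / (y * d))"
proof -
  define N where "N = nat \<lfloor>1 / (y * d)\<rfloor>"
  have N: "real N \<le> 1 / (y * d)" "1 / (y * d) < real N + 1"
    using y d unfolding N_def by (auto simp: of_nat_nat)
  define I where "I k = integral {d..min 1 (1 / (real k * y))} (kerK x)" for k
  have I: "((\<lambda>z. if z \<in> {d..min 1 (1 / (real k * y))} then kerK x z else 0) has_integral I k) {d..1}"
    and I_le: "\<bar>I k\<bar> \<le> x" if "k \<in> {1..N}" for k
  proof -
    have "real k \<le> 1 / (y * d)" using that N by simp
    then have "d \<le> 1 / (real k * y)" using that y d by (simp add: field_simps)
    with d have le: "d \<le> min 1 (1 / (real k * y))" by simp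
    show "\<bar>I k\<bar> \<le> x"
      unfolding I_def using x d le by (intro kerK_integral_bounds) auto
    have "(kerK x has_integral I k) {d..min 1 (1 / (real k * y))}"
      unfolding I_def using x d le by (intro integrable_integral kerK_integral_bounds) auto
    then show "((\<lambda>z. if z \<in> {d..min 1 (1 / (real k * y))} then kerK x z else 0) has_integral I k) {d..1}"
      by (subst has_integral_restrict) auto
  qed
  define J1 where "J1 = integral {d..1} (kerK x)"
  define J2 where "J2 = integral {d..1} (\<lambda>z. kerK x z / z)"
  have J1: "(kerK x has_integral J1) {d..1}" and J2: "((\<lambda>z. kerK x z / z) has_integral J2) {d..1}"
    unfolding J1_def J2_def using x d by (intro integrable_integral kerK_integral_bounds; simp)+
  have J_le: "\<bar>J1\<bar> \<le> x" "\<bar>J2\<bar> \<le> x"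
    unfolding J1_def J2_def using x d by (intro kerK_integral_bounds; simp)+
  \<comment> \<open>Integrated form of
    \<open>kerK z y = 1/2 - 1 / (z * y) + \<lfloor>1 / (z * y)\<rfloor>\<close>, multiplied by
    \<open>kerK x z\<close>.\<close>
  have "((\<lambda>z. 1/2 * kerK x z - 1/y * (kerK x z / z)
      + (\<Sum>k=1..N. if z \<in> {d..min 1 (1 / (real k * y))} then kerK x z else 0))
      has_integral 1/2 * J1 - 1/y * J2 + (\<Sum>k=1..N. I k)) {d..1}"
    using I by (intro has_integral_add has_integral_diff has_integral_mult_right has_integral_sum J1 J2) auto
  moreover have "1/2 * kerK x z - 1/y * (kerK x z / z)
      + (\<Sum>k=1..N. if z \<in> {d..min 1 (1 / (real k * y))} then kerK x z else 0)
      = kerK x z * kerK z y" if z: "z \<in> {d..1}" for z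
  proof -
    have z0: "0 < z" using z d by simp
    have "1 / (z * y) \<le> 1 / (y * d)"
      using z y d by (simp add: field_simps)
    then have "1 / (z * y) < real N + 1" using N by simp
    have "(\<Sum>k=1..N. if z \<in> {d..min 1 (1 / (real k * y))} then kerK x z else 0)
      = (\<Sum>k=1..N. kerK x z * (if real k \<le> 1 / (z * y) then 1 else 0))"
      using z z0 y by (intro sum.cong) (auto simp: field_simps)
    also have "\<dots> = kerK x z * of_int \<lfloor>1 / (z * y)\<rfloor>"
      using z0 y \<open>1 / (z * y) < real N + 1\<close>
      by (subst sum_distrib_left [symmetric], subst floor_eq_sum_indicator) auto
    finally show ?thesis
      using z0 y by (simp add: kerK_def[of z y] frac_def algebra_simps)
  qed
  ultimately have *: "((\<lambda>z. kerK x z * kerK z y) has_integral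
      1/2 * J1 - 1/y * J2 + (\<Sum>k=1..N. I k)) {d..1}"
    by (rule has_integral_eq [rotated])
  then show "(\<lambda>z. kerK x z * kerK z y) integrable_on {d..1}" by blast
  have "\<bar>\<Sum>k=1..N. I k\<bar> \<le> (\<Sum>k=1..N. x)"
    using I_le by (intro order_trans[OF sum_abs] sum_mono) auto
  also have "\<dots> \<le> 1 / (y * d) * x"
    using mult_right_mono[OF N(1), of x] x by simp
  finally have a: "\<bar>\<Sum>k=1..N. I k\<bar> \<le> x / (y * d)" by simp
  have "1/y * \<bar>J2\<bar> \<le> 1/y * x"
    using J_le y by (intro mult_left_mono) auto
  also have "\<dots> \<le> x / (y * d)"
    using x y d by (simp add: field_simps)
  finally have b: "\<bar>1/y * J2\<bar> \<le> x / (y * d)"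
    using y by (simp add: abs_mult)
  have "y * d \<le> 1" using y d by (simp add: mult_le_one)
  then have "x \<le> x / (y * d)"
    using x y d by (simp add: field_simps)
  then have c: "\<bar>1/2 * J1\<bar> \<le> 1/2 * (x / (y * d))"
    using J_le by simp
  show "\<bar>integral {d..1} (\<lambda>z. kerK x z * kerK z y)\<bar> \<le> 5/2 * (x / (y * d))"
    unfolding integral_unique[OF *] using a b c by linarith
qed

text \<open>The range is split at \<open>d = sqrt (x / y)\<close>, which balances the trivial bound
  \<open>d / 4\<close> near the origin against the tail bound
  \<open>5/2 * x / (y * d) = 5/2 * d\<close>; together they stay below \<open>3 * d\<close>. For
  \<open>x \<ge> y\<close> the trivial bound 1/4 on the whole interval suffices.\<close>

lemma kerK_iterate_bound:
  assumes x: "0 < x" and y: "0 < y" "y \<le> 1"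
  shows "\<bar>LINT z:{0..1}|lborel. kerK x z * kerK z y\<bar> \<le> 3 * sqrt (x / y)"
proof -
  define g where "g z = kerK x z * kerK z y" for z
  have g_le: "\<bar>g z\<bar> \<le> 1/4" for z
    using mult_mono[OF kerK_abs_le[of x z] kerK_abs_le[of z y]] by (simp add: g_def abs_mult)
  have [measurable]: "g \<in> borel_measurable borel"
    unfolding g_def by measurable
  have "set_integrable lborel {0..1} g"
    unfolding set_integrable_def
    by (rule integrableI_bounded_set_indicator[where B = "1/4"]) (use g_le in auto)
  then have gi: "g integrable_on {0..1}" and g_eq: "(LINT z:{0..1}|lborel. g z) = integral {0..1} g"
    by (auto simp: set_borel_integral_eq_integral)
  have bound: "\<bar>integral {0..c} g\<bar> \<le> 1/4 * c" if "0 \<le> c" "c \<le> 1" for c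
    using has_integral_bound_real[of "1/4" _ g "integral {0..c} g" 0 c] that g_le
      integrable_integral[OF integrable_subinterval_real[OF gi, of 0 c]] by auto
  have "\<bar>integral {0..1} g\<bar> \<le> 3 * sqrt (x / y)"
  proof (cases "x < y")
    case True
    define d where "d = sqrt (x / y)"
    have d: "0 < d" "d \<le> 1" "x / (y * d) = d"
      using True x y by (auto simp: d_def field_simps real_sqrt_divide)
    have "integral {0..1} g = integral {0..d} g + integral {d..1} g"
      using d gi by (simp add: Henstock_Kurzweil_Integration.integral_combine)
    moreover have "\<bar>integral {d..1} g\<bar> \<le> 5/2 * d"
      using kerK_iterate_tail_bound(2)[OF x y d(1,2)] d(3) by (simp add: g_def[abs_def])
    ultimately show ?thesis
      using bound[of d] d(1,2) by (simp flip: d_def)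
  next
    case False
    then have "1 \<le> sqrt (x / y)"
      using y by simp
    then show ?thesis
      using bound[of 1] by linarith
  qed
  then show ?thesis
    by (simp add: g_eq flip: g_def)
qed

lemma isCont_kerK:
  assumes "x \<noteq> 0" "y \<noteq> 0" "1 / (x * y) \<notin> \<int>"
  shows "isCont (\<lambda>x. kerK x y) x"
proof -
  have "isCont (\<lambda>x. 1/2 - frac (1 / (x * y))) x"
    using assms by (intro continuous_intros isCont_o2[OF _ continuous_frac]) auto
  moreover have "\<forall>\<^sub>F t in nhds x. 1/2 - frac (1 / (t * y)) = kerK t y"
    by (rule eventually_mono[OF t1_space_nhds[OF assms(1)]]) (use assms in \<open>auto simp: kerK_def\<close>)
  ultimately show ?thesis
    by (rule isCont_cong[THEN iffD1, rotated])
qed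

text \<open>The common majorant: it absorbs the factor \<open>1 / sqrt y\<close> of the iterated
  kernel, and later dominates \<open>ph y / y\<close>.\<close>

lemma integrable_powr_neg_half:
  "integrable lborel (\<lambda>y. indicator {0..1} y * y powr (-1/2) :: real)"
proof -
  have "set_integrable lebesgue {0..1::real} (\<lambda>y. y powr (-1/2))"
    by (intro nonnegative_absolutely_integrable_1 integrable_on_powr_from_0) auto
  then show ?thesis
    unfolding set_integrable_def by (subst (asm) integrable_completion) auto
qed

section \<open>Decay of eigenfunctions at the origin\<close>

locale kerK_eigenfunction =
  fixes ph :: "real \<Rightarrow> real" and lm :: real
  assumes L2: "L2 ph"
    and eigen: "\<And>x. x \<in> {0..1} \<Longrightarrow> ph x = lm * (LINT y:{0..1}|lebesgue. kerK x y * ph y)"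
begin

lemma ph_0: "ph 0 = 0"
  using eigen[of 0] by (simp add: kerK_def)

text \<open>Square integrability implies integrability on a set of finite measure, here through the
  pointwise inequality \<open>\<bar>t\<bar> \<le> 1 + t\<^sup>2\<close>.\<close>

lemma set_integrable_ph: "set_integrable lebesgue {0..1} ph"
proof (rule set_integrable_bound)
  show "set_integrable lebesgue {0..1} (\<lambda>x. 1 + (ph x)\<^sup>2)"
    using L2 by (intro set_integral_add) (auto simp: L2_def set_integrable_def integrable_completion)
  show "set_borel_measurable lebesgue {0..1} ph"
    using L2 by (simp add: L2_def)
  have "\<bar>t\<bar> \<le> \<bar>1 + t\<^sup>2\<bar>" for t :: real
  proof -
    have "0 \<le> (\<bar>t\<bar> - 1/2)\<^sup>2" by simp
    then show ?thesis by (simp add: power2_eq_square algebra_simps abs_if split: if_splits)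
  qed
  then show "AE x in lebesgue. x \<in> {0..1} \<longrightarrow> norm (ph x) \<le> norm (1 + (ph x)\<^sup>2)"
    by simp
qed

lemma norm_kerK_mult_ph_le: "norm (kerK x y * ph y) \<le> norm (ph y)"
  using mult_right_mono[OF order_trans[OF kerK_abs_le[of x y], of 1], of "\<bar>ph y\<bar>"]
  by (simp add: abs_mult)

lemma set_borel_measurable_kerK_mult_ph: "set_borel_measurable lebesgue {0..1} (\<lambda>y. kerK x y * ph y)"
proof -
  have [measurable]: "kerK x \<in> borel_measurable lebesgue"
    by (rule measurable_completion) measurable
  have [measurable]: "(\<lambda>y. indicator {0..1} y *\<^sub>R ph y) \<in> borel_measurable lebesgue"
    using L2 by (simp add: L2_def set_borel_measurable_def)
  have "(\<lambda>y. kerK x y * (indicator {0..1} y *\<^sub>R ph y)) \<in> borel_measurable lebesgue"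
    by measurable
  then show ?thesis
    by (simp add: set_borel_measurable_def mult_ac)
qed

lemma set_integrable_kerK_mult_ph: "set_integrable lebesgue {0..1} (\<lambda>y. kerK x y * ph y)"
  by (rule set_integrable_bound[OF set_integrable_ph set_borel_measurable_kerK_mult_ph])
     (use norm_kerK_mult_ph_le in auto)

text \<open>The kernel is bounded and the eigenvalue equation holds at every point, so the integral
  of the absolute value of \<open>ph\<close> controls all its values.\<close>

lemma ph_bounded: obtains M where "0 \<le> M" "\<And>x. x \<in> {0..1} \<Longrightarrow> \<bar>ph x\<bar> \<le> M"
proof
  show "\<bar>ph x\<bar> \<le> \<bar>lm\<bar> * (LINT y:{0..1}|lebesgue. \<bar>ph y\<bar>)" if "x \<in> {0..1}" for x
  proof -
    have "\<bar>LINT y:{0..1}|lebesgue. kerK x y * ph y\<bar> \<le> (LINT y:{0..1}|lebesgue. \<bar>kerK x y * ph y\<bar>)"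
      using set_integral_norm_bound[OF set_integrable_kerK_mult_ph] by simp
    also have "\<dots> \<le> (LINT y:{0..1}|lebesgue. \<bar>ph y\<bar>)"
      using norm_kerK_mult_ph_le
      by (intro set_integral_mono set_integrable_abs set_integrable_kerK_mult_ph set_integrable_ph) auto
    finally show ?thesis
      using eigen[OF that] by (simp add: abs_mult mult_left_mono)
  qed
  show "0 \<le> \<bar>lm\<bar> * (LINT y:{0..1}|lebesgue. \<bar>ph y\<bar>)"
    by (simp add: set_lebesgue_integral_def)
qed

text \<open>Dominated convergence under the integral: for fixed \<open>a > 0\<close> the kernel is
  continuous in its first argument at \<open>a\<close> for all but countably many
  \<open>y\<close>.\<close>

lemma continuous_on_ph_pos: "continuous_on {0<..1} ph"
proof (rule continuous_on_sequentiallyI)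
  fix u :: "nat \<Rightarrow> real" and a
  assume u: "\<forall>n. u n \<in> {0<..1}" and a: "a \<in> {0<..1}" and lim: "u \<longlonglongrightarrow> a"
  \<comment> \<open>The points where \<open>kerK a\<close> may jump, together with 0, where the
    kernel is given by its other branch.\<close>
  define E where "E = insert 0 (range (\<lambda>i::int. 1 / (a * of_int i)))"
  have "E \<in> null_sets lborel"
    unfolding E_def by (intro countable_imp_null_set_lborel) auto
  then have "AE y in lborel. y \<notin> E"
    by (rule AE_not_in)
  then have E: "AE y in lebesgue. y \<notin> E"
    by (rule AE_completion)
  have lim_ker: "(\<lambda>n. kerK (u n) y) \<longlonglongrightarrow> kerK a y" if "y \<notin> E" for y
  proof -
    have "1 / (a * y) \<notin> \<int>"
    proof
      assume "1 / (a * y) \<in> \<int>"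
      then obtain i :: int where i: "1 / (a * y) = of_int i" by (auto elim: Ints_cases)
      have "y = 1 / (a * of_int i)"
        unfolding i[symmetric] using a by simp
      then show False using that unfolding E_def by blast
    qed
    then show ?thesis
      using isCont_tendsto_compose[OF isCont_kerK lim, of y] a that by (auto simp: E_def)
  qed
  have "(\<lambda>n. LINT y:{0..1}|lebesgue. kerK (u n) y * ph y) \<longlonglongrightarrow> (LINT y:{0..1}|lebesgue. kerK a y * ph y)"
    unfolding set_lebesgue_integral_def
  proof (rule integral_dominated_convergence)
    show "integrable lebesgue (\<lambda>y. indicator {0..1} y *\<^sub>R \<bar>ph y\<bar>)"
      using set_integrable_abs[OF set_integrable_ph] by (simp add: set_integrable_def)
    show "AE y in lebesgue. (\<lambda>n. indicator {0..1} y *\<^sub>R (kerK (u n) y * ph y))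
        \<longlonglongrightarrow> indicator {0..1} y *\<^sub>R (kerK a y * ph y)"
      using E by eventually_elim (intro tendsto_intros lim_ker)
    show "AE y in lebesgue. norm (indicator {0..1} y *\<^sub>R (kerK (u n) y * ph y))
        \<le> indicator {0..1} y *\<^sub>R \<bar>ph y\<bar>" for n
      using norm_kerK_mult_ph_le by (auto simp: indicator_def)
  qed (use set_borel_measurable_kerK_mult_ph in \<open>auto simp: set_borel_measurable_def\<close>)
  then have "(\<lambda>n. lm * (LINT y:{0..1}|lebesgue. kerK (u n) y * ph y))
      \<longlonglongrightarrow> lm * (LINT y:{0..1}|lebesgue. kerK a y * ph y)"
    by (rule tendsto_mult_left)
  moreover have "ph (u n) = lm * (LINT y:{0..1}|lebesgue. kerK (u n) y * ph y)" for n
    using u by (intro eigen) (auto intro: less_imp_le)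
  moreover have "ph a = lm * (LINT y:{0..1}|lebesgue. kerK a y * ph y)"
    using a by (intro eigen) auto
  ultimately show "(\<lambda>n. ph (u n)) \<longlonglongrightarrow> ph a"
    by simp
qed

text \<open>The eigenvalue equation is applied twice: the iterated kernel, unlike the kernel itself,
  decays as its first argument tends to zero.\<close>

lemma ph_decay: obtains C where "0 \<le> C" "\<And>x. x \<in> {0..1} \<Longrightarrow> \<bar>ph x\<bar> \<le> C * sqrt x"
proof -
  obtain M where M: "0 \<le> M" "\<And>x. x \<in> {0..1} \<Longrightarrow> \<bar>ph x\<bar> \<le> M"
    using ph_bounded by blast
  \<comment> \<open>A Borel version of \<open>ph\<close> extended by zero: \<open>ph\<close> is only
    known to be Lebesgue measurable on the unit interval and is arbitrary outside it, whereas Fubini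
    is applied on the Borel product. Dropping the origin is harmless because
    \<open>kerK x 0 = 0\<close>.\<close>
  define f where "f y = indicator {0<..1} y *\<^sub>R ph y" for y
  have [measurable]: "f \<in> borel_measurable borel"
    unfolding f_def by (intro borel_measurable_continuous_on_indicator continuous_on_ph_pos) auto
  have f_le: "\<bar>f y\<bar> \<le> M" for y
    using M by (auto simp: f_def indicator_def)
  have f_eigen: "ph x = lm * (\<integral>y. kerK x y * f y \<partial>lborel)" if "x \<in> {0..1}" for x
  proof -
    have "(\<lambda>y. indicator {0..1} y *\<^sub>R (kerK x y * ph y)) = (\<lambda>y. kerK x y * f y)"
      by (auto simp: f_def indicator_def kerK_def)
    then have "(LINT y:{0..1}|lebesgue. kerK x y * ph y) = (\<integral>y. kerK x y * f y \<partial>lebesgue)"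
      by (simp add: set_lebesgue_integral_def)
    also have "\<dots> = (\<integral>y. kerK x y * f y \<partial>lborel)"
      by (intro integral_completion) measurable
    finally show ?thesis
      using eigen[OF that] by simp
  qed
  define R where "R = (\<integral>y. indicator {0..1} y * y powr (-1/2) \<partial>lborel :: real)"
  have R: "0 \<le> R"
    unfolding R_def by simp
  have main: "\<bar>ph x\<bar> \<le> (3 * lm\<^sup>2 * M * R) * sqrt x" if x: "x \<in> {0<..1}" for x
  proof -
    \<comment> \<open>Bounded and supported in the unit square, hence integrable; exchanging the
      integrations makes the iterated kernel appear.\<close>
    define G where "G z y = indicator {0..1} z * kerK x z * kerK z y * f y" for z y
    have G_le: "\<bar>G z y\<bar> \<le> M" for z y
    proof -
      have "\<bar>kerK x z\<bar> * \<bar>kerK z y\<bar> * \<bar>f y\<bar> \<le> 1 * 1 * M"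
        using kerK_abs_le[of x z] kerK_abs_le[of z y] f_le[of y] by (intro mult_mono) auto
      then show ?thesis
        using M by (auto simp: G_def indicator_def abs_mult)
    qed
    have "integrable (lborel \<Otimes>\<^sub>M lborel) (case_prod G)"
    proof (rule integrableI_bounded_set[where A = "{0..1} \<times> {0..1}" and B = M])
      show "case_prod G \<in> borel_measurable (lborel \<Otimes>\<^sub>M lborel)"
        unfolding G_def by measurable
      show "emeasure (lborel \<Otimes>\<^sub>M lborel) ({0..1::real} \<times> {0..1::real}) < \<infinity>"
        by (subst lborel.emeasure_pair_measure_Times) (auto simp: ennreal_mult_less_top)
      show "AE p in lborel \<Otimes>\<^sub>M lborel. p \<in> {0..1} \<times> {0..1} \<longrightarrow> norm (case_prod G p) \<le> M"
        using G_le by auto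
      show "AE p in lborel \<Otimes>\<^sub>M lborel. p \<notin> {0..1} \<times> {0..1} \<longrightarrow> case_prod G p = 0"
        by (auto simp: G_def f_def indicator_def)
    qed auto
    note swap = lborel_pair.Fubini_integral[OF this]
    \<comment> \<open>The second use of the eigenvalue equation, inside the first integral. At
      \<open>z = 0\<close>, where \<open>f\<close> need not agree with the integral formula, the
      outer kernel vanishes.\<close>
    have "kerK x z * f z = lm * (\<integral>y. G z y \<partial>lborel)" for z
    proof -
      have "kerK x z * f z = indicator {0..1} z * kerK x z * (lm * (\<integral>y. kerK z y * f y \<partial>lborel))"
        using f_eigen[of z] by (cases "z = 0") (auto simp: f_def indicator_def kerK_def)
      also have "\<dots> = lm * (\<integral>y. indicator {0..1} z * kerK x z * (kerK z y * f y) \<partial>lborel)"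
        by simp
      finally show ?thesis
        by (simp add: G_def mult_ac)
    qed
    then have "ph x = lm * (\<integral>z. lm * (\<integral>y. G z y \<partial>lborel) \<partial>lborel)"
      using f_eigen[of x] x by auto
    also have "\<dots> = lm\<^sup>2 * (\<integral>y. (\<integral>z. G z y \<partial>lborel) \<partial>lborel)"
      by (simp add: power2_eq_square swap)
    also have "(\<lambda>y. \<integral>z. G z y \<partial>lborel) = (\<lambda>y. (LINT z:{0..1}|lborel. kerK x z * kerK z y) * f y)"
      by (auto simp: G_def set_lebesgue_integral_def mult_ac)
    finally have ph_eq: "ph x = lm\<^sup>2 * (\<integral>y. (LINT z:{0..1}|lborel. kerK x z * kerK z y) * f y \<partial>lborel)" .
    have le: "\<bar>(LINT z:{0..1}|lborel. kerK x z * kerK z y) * f y\<bar>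
        \<le> 3 * sqrt x * M * (indicator {0..1} y * y powr (-1/2))" for y
    proof (cases "y \<in> {0<..1}")
      case True
      have "\<bar>(LINT z:{0..1}|lborel. kerK x z * kerK z y) * f y\<bar> \<le> 3 * sqrt (x / y) * M"
        unfolding abs_mult using True x f_le M by (intro mult_mono kerK_iterate_bound) auto
      also have "sqrt (x / y) = sqrt x * y powr (-1/2)"
        using True powr_minus_divide[of y "1/2"] by (simp add: real_sqrt_divide powr_half_sqrt)
      finally show ?thesis
        using True by (simp add: mult_ac)
    next
      case False
      then show ?thesis
        using M x by (auto simp: f_def)
    qed
    have "\<bar>\<integral>y. (LINT z:{0..1}|lborel. kerK x z * kerK z y) * f y \<partial>lborel\<bar>
        \<le> (\<integral>y. \<bar>(LINT z:{0..1}|lborel. kerK x z * kerK z y) * f y\<bar> \<partial>lborel)"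
      by (rule integral_abs_bound)
    also have "\<dots> \<le> (\<integral>y. 3 * sqrt x * M * (indicator {0..1} y * y powr (-1/2)) \<partial>lborel)"
      using integrable_powr_neg_half M x
      by (intro integral_mono' integrable_mult_right le) auto
    also have "\<dots> = 3 * sqrt x * M * R"
      by (simp add: R_def)
    finally have "lm\<^sup>2 * \<bar>\<integral>y. (LINT z:{0..1}|lborel. kerK x z * kerK z y) * f y \<partial>lborel\<bar>
        \<le> lm\<^sup>2 * (3 * sqrt x * M * R)"
      by (rule mult_left_mono) simp
    then show ?thesis
      by (simp add: ph_eq abs_mult mult_ac)
  qed
  show ?thesis
  proof
    show "0 \<le> 3 * lm\<^sup>2 * M * R"
      using M R by simp
    show "\<bar>ph x\<bar> \<le> (3 * lm\<^sup>2 * M * R) * sqrt x" if "x \<in> {0..1}" for x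
      using main[of x] that ph_0 by (cases "x = 0") auto
  qed
qed

text \<open>Only the origin is new; there the decay forces \<open>ph\<close> to tend to
  \<open>ph 0 = 0\<close>.\<close>

lemma continuous_on_ph: "continuous_on {0..1} ph"
proof -
  obtain C where C: "\<And>x. x \<in> {0..1} \<Longrightarrow> \<bar>ph x\<bar> \<le> C * sqrt x"
    using ph_decay by blast
  have "(ph \<longlongrightarrow> ph x) (at x within {0..1})" if x: "x \<in> {0..1}" for x
  proof (cases "x = 0")
    case True
    have "((\<lambda>x. C * sqrt x) \<longlongrightarrow> C * sqrt 0) (at 0 within {0..1})"
      by (intro tendsto_intros)
    moreover have "\<forall>\<^sub>F x in at 0 within {0..1}. norm (ph x) \<le> C * sqrt x"
      using C by (auto simp: eventually_at_filter)
    ultimately show ?thesis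
      using True ph_0 by (auto intro: Lim_null_comparison)
  next
    case False
    then have "at x within {0..1} = at x within {0<..1}"
      using x by (intro at_within_nhd[of _ "{0<..}"]) auto
    then show ?thesis
      using continuous_on_ph_pos x False by (auto simp: continuous_on_def)
  qed
  then show ?thesis
    by (simp add: continuous_on_def)
qed

text \<open>The decay \<open>sqrt y\<close> against \<open>1 / y\<close> leaves a multiple of the
  integrable \<open>y powr (-1/2)\<close>.\<close>

lemma set_integrable_ph_divide: "set_integrable lebesgue {0..1} (\<lambda>y. ph y / y)"
proof -
  obtain C where C: "0 \<le> C" "\<And>x. x \<in> {0..1} \<Longrightarrow> \<bar>ph x\<bar> \<le> C * sqrt x"
    using ph_decay by blast
  show ?thesis
  proof (rule set_integrable_bound)
    show "set_integrable lebesgue {0..1} (\<lambda>y::real. C * y powr (-1/2))"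
      using integrable_powr_neg_half unfolding set_integrable_def
      by (subst integrable_completion) (auto simp: mult.left_commute)
    \<comment> \<open>The quotient is continuous on the half-open interval, and adding the origin
      changes nothing since division by zero gives 0.\<close>
    have "(\<lambda>y. indicator {0<..1} y *\<^sub>R (ph y / y)) \<in> borel_measurable borel"
      by (intro borel_measurable_continuous_on_indicator continuous_intros continuous_on_ph_pos) auto
    moreover have "(\<lambda>y. indicator {0<..1} y *\<^sub>R (ph y / y)) = (\<lambda>y. indicator {0..1} y *\<^sub>R (ph y / y))"
      by (auto simp: fun_eq_iff indicator_def)
    ultimately show "set_borel_measurable lebesgue {0..1} (\<lambda>y. ph y / y)"
      unfolding set_borel_measurable_def by (intro measurable_completion) simp
    have "norm (ph y / y) \<le> norm (C * y powr (-1/2))" if "y \<in> {0..1}" for y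
    proof (cases "y = 0")
      case False
      then have y: "0 < y" using that by simp
      have "norm (ph y / y) \<le> C * (sqrt y / y)"
        using C(2)[OF that] y by (simp add: divide_right_mono)
      also have "sqrt y / y = y powr (-1/2)"
        using y powr_minus_divide[of y "1/2"] by (simp add: powr_half_sqrt sqrt_divide_self_eq inverse_eq_divide)
      finally show ?thesis by simp
    qed simp
    then show "AE y in lebesgue. y \<in> {0..1} \<longrightarrow> norm (ph y / y) \<le> norm (C * y powr (-1/2))"
      by simp
  qed
qed

section \<open>Termwise differentiation\<close>

definition Phi1 :: real where "Phi1 = (LINT y:{0..1}|lebesgue. ph y / y)"

definition Psi :: "real \<Rightarrow> real" where "Psi t = integral {0..t} ph"

lemma Psi_has_real_derivative:
  assumes "0 < t" "t < 1"
  shows "(Psi has_real_derivative ph t) (at t)"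
  using integral_has_real_derivative[OF continuous_on_ph, of t] assms
  by (simp add: Psi_def[abs_def] at_within_Icc_at)

text \<open>Each indicator of \<open>y \<le> 1 / (k * x)\<close> integrates against
  \<open>ph\<close> to a value of \<open>Psi\<close>. Passing to the full floor is dominated
  convergence with majorant \<open>\<bar>ph y / y\<bar> / x\<close>; the parts 1/2 and
  \<open>1 / (x * y)\<close> of the kernel produce the other two terms.\<close>

lemma ph_eq_floor_integral:
  assumes x: "0 < x" "x \<le> 1"
  shows "(\<lambda>N. \<Sum>k=1..N. Psi (min 1 (1 / (real k * x))))
           \<longlonglongrightarrow> integral {0..1} (\<lambda>y. of_int \<lfloor>1 / (x * y)\<rfloor> * ph y)"
    and "ph x = lm * (Psi 1 / 2 - Phi1 / x + integral {0..1} (\<lambda>y. of_int \<lfloor>1 / (x * y)\<rfloor> * ph y))"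
proof -
  define F where "F N y = (\<Sum>k=1..N. if y \<in> {0..min 1 (1 / (real k * x))} then ph y else 0)" for N y
  have F_eq: "F N y = (\<Sum>k=1..N. if real k \<le> 1 / (x * y) then 1 else 0) * ph y"
    if "y \<in> {0..1}" for N y
  \<comment> \<open>At the origin the left side counts every \<open>k\<close> and the right side
    none, because \<open>1 / 0 = 0\<close>; both vanish with \<open>ph 0\<close>.\<close>
  proof (cases "y = 0")
    case True
    then show ?thesis by (simp add: F_def ph_0 sum.neutral)
  next
    case False
    show ?thesis
      unfolding F_def sum_distrib_right
      using that False x by (intro sum.cong) (auto simp: field_simps)
  qed
  have Psi: "((\<lambda>y. if y \<in> {0..min 1 (1 / (real k * x))} then ph y else 0)
      has_integral Psi (min 1 (1 / (real k * x)))) {0..1}" for k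
  proof (subst has_integral_restrict)
    show "(ph has_integral Psi (min 1 (1 / (real k * x)))) {0..min 1 (1 / (real k * x))}"
      unfolding Psi_def
      by (intro integrable_integral integrable_continuous_real continuous_on_subset[OF continuous_on_ph]) auto
  qed auto
  have F_int: "(F N has_integral (\<Sum>k=1..N. Psi (min 1 (1 / (real k * x))))) {0..1}" for N
    unfolding F_def by (intro has_integral_sum Psi) auto
  have dom: "(\<lambda>y. \<bar>ph y / y\<bar> / x) integrable_on {0..1}"
    using set_integrable_abs[OF set_integrable_ph_divide]
    by (intro integrable_on_divide set_lebesgue_integral_eq_integral(1))
  have F_le: "norm (F N y) \<le> \<bar>ph y / y\<bar> / x" if y: "y \<in> {0..1}" for N y
  proof -
    define s where "s = (\<Sum>k=1..N. if real k \<le> 1 / (x * y) then 1 else (0::real))"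
    have "0 \<le> s"
      unfolding s_def by (intro sum_nonneg) auto
    moreover have "s \<le> 1 / (x * y)"
      unfolding s_def using x y by (intro sum_indicator_le) auto
    ultimately have "\<bar>s * ph y\<bar> \<le> 1 / (x * y) * \<bar>ph y\<bar>"
      unfolding abs_mult by (intro mult_right_mono) auto
    then show ?thesis
      using x y by (simp add: F_eq[OF y] s_def mult.commute)
  qed
  \<comment> \<open>For fixed \<open>y\<close> the sequence is constant once \<open>N\<close>
    exceeds \<open>1 / (x * y)\<close>.\<close>
  have F_lim: "(\<lambda>N. F N y) \<longlonglongrightarrow> of_int \<lfloor>1 / (x * y)\<rfloor> * ph y" if y: "y \<in> {0..1}" for y
  proof (rule tendsto_eventually)
    obtain N0 :: nat where N0: "1 / (x * y) < real N0"
      using reals_Archimedean2 by blast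
    have "F N y = of_int \<lfloor>1 / (x * y)\<rfloor> * ph y" if "N \<ge> N0" for N
      unfolding F_eq[OF y] using x y N0 that by (subst floor_eq_sum_indicator) auto
    then show "\<forall>\<^sub>F N in sequentially. F N y = of_int \<lfloor>1 / (x * y)\<rfloor> * ph y"
      by (auto simp: eventually_sequentially)
  qed
  have fl: "(\<lambda>y. of_int \<lfloor>1 / (x * y)\<rfloor> * ph y) integrable_on {0..1}"
    and lim: "(\<lambda>N. integral {0..1} (F N)) \<longlonglongrightarrow> integral {0..1} (\<lambda>y. of_int \<lfloor>1 / (x * y)\<rfloor> * ph y)"
    using dominated_convergence[OF _ dom F_le F_lim] F_int by blast+
  show "(\<lambda>N. \<Sum>k=1..N. Psi (min 1 (1 / (real k * x))))
           \<longlonglongrightarrow> integral {0..1} (\<lambda>y. of_int \<lfloor>1 / (x * y)\<rfloor> * ph y)"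
    using lim integral_unique[OF F_int] by simp
  have "(ph has_integral Psi 1) {0..1}"
    unfolding Psi_def by (intro integrable_integral integrable_continuous_real continuous_on_ph)
  moreover have "((\<lambda>y. ph y / y) has_integral Phi1) {0..1}"
    unfolding Phi1_def by (intro has_integral_set_lebesgue set_integrable_ph_divide)
  ultimately have "((\<lambda>y. 1/2 * ph y - 1/x * (ph y / y) + of_int \<lfloor>1 / (x * y)\<rfloor> * ph y) has_integral
      1/2 * Psi 1 - 1/x * Phi1 + integral {0..1} (\<lambda>y. of_int \<lfloor>1 / (x * y)\<rfloor> * ph y)) {0..1}"
    by (intro has_integral_add has_integral_diff has_integral_mult_right integrable_integral fl)
  moreover have "1/2 * ph y - 1/x * (ph y / y) + of_int \<lfloor>1 / (x * y)\<rfloor> * ph y = kerK x y * ph y" for y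
    using x ph_0 by (cases "y = 0") (simp_all add: kerK_def frac_def algebra_simps)
  ultimately have "((\<lambda>y. kerK x y * ph y) has_integral
      1/2 * Psi 1 - 1/x * Phi1 + integral {0..1} (\<lambda>y. of_int \<lfloor>1 / (x * y)\<rfloor> * ph y)) {0..1}"
    by simp
  from integral_unique[OF this]
  show "ph x = lm * (Psi 1 / 2 - Phi1 / x + integral {0..1} (\<lambda>y. of_int \<lfloor>1 / (x * y)\<rfloor> * ph y))"
    using eigen[of x] x set_lebesgue_integral_eq_integral(2)[OF set_integrable_kerK_mult_ph, of x] by simp
qed

text \<open>On this interval the minimum with 1 is attained by 1 for \<open>k \<le> n\<close> and by
  \<open>1 / (k * x)\<close> afterwards. The first \<open>n\<close> terms therefore become
  \<open>n * Psi 1\<close> and join \<open>Psi 1 / 2\<close>, leaving summands of a fixed form that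
  can be differentiated in \<open>x\<close>.\<close>

lemma ph_expansion:
  fixes n :: nat
  assumes n: "n \<ge> 1" and x: "1 / real (n + 1) < x" "x < 1 / real n"
  shows "summable (\<lambda>m. if m \<ge> n + 1 then Psi (1 / (real m * x)) else 0)"
    and "ph x = lm * ((real n + 1/2) * Psi 1 - Phi1 / x
           + (\<Sum>m. if m \<ge> n + 1 then Psi (1 / (real m * x)) else 0))"
proof -
  define T where "T m = (if m \<ge> n + 1 then Psi (1 / (real m * x)) else 0)" for m
  have x01: "0 < x" "x \<le> 1"
  proof -
    have "0 < 1 / real (n + 1)" by simp
    with x show "0 < x" by linarith
    have "1 / real n \<le> 1" using n by simp
    with x show "x \<le> 1" by linarith
  qed
  define L where "L = integral {0..1} (\<lambda>y. of_int \<lfloor>1 / (x * y)\<rfloor> * ph y)"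
  have big: "1 \<le> 1 / (real k * x)" if "k \<in> {1..n}" for k
  proof -
    have "real k * x \<le> real n * x" using that x01 by (intro mult_right_mono) auto
    also have "\<dots> \<le> 1" using x n by (simp add: field_simps)
    finally show ?thesis using that x01 by (simp add: field_simps)
  qed
  have small: "1 / (real k * x) \<le> 1" if "k \<ge> n + 1" for k
  proof -
    have "1 \<le> real (n + 1) * x" using x by (simp add: field_simps)
    also have "\<dots> \<le> real k * x" using that x01 by (intro mult_right_mono) auto
    finally show ?thesis using that x01 by (simp add: field_simps)
  qed
  \<comment> \<open>The sum over \<open>m < Suc N\<close> also runs through 0 to \<open>n\<close>,
    where \<open>T\<close> is zero; the shift by one is removed by
    \<open>LIMSEQ_imp_Suc\<close>.\<close>
  have "(\<Sum>k=1..N. Psi (min 1 (1 / (real k * x)))) = real n * Psi 1 + (\<Sum>m<Suc N. T m)"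
    if "N \<ge> n" for N
  proof -
    have "{1..N} = {1..n} \<union> {n+1..N}" using that by auto
    then have "(\<Sum>k=1..N. Psi (min 1 (1 / (real k * x))))
        = (\<Sum>k=1..n. Psi (min 1 (1 / (real k * x)))) + (\<Sum>k=n+1..N. Psi (min 1 (1 / (real k * x))))"
      by (simp add: sum.union_disjoint)
    also have "(\<Sum>k=1..n. Psi (min 1 (1 / (real k * x)))) = (\<Sum>k=1..n. Psi 1)"
      using big by (intro sum.cong) (auto simp: min_def)
    also have "(\<Sum>k=n+1..N. Psi (min 1 (1 / (real k * x)))) = (\<Sum>k=n+1..N. T k)"
      using small by (intro sum.cong) (auto simp: T_def min_absorb2)
    also have "\<dots> = (\<Sum>m<Suc N. T m)"
      by (intro sum.mono_neutral_left) (auto simp: T_def)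
    finally show ?thesis by simp
  qed
  then have "\<forall>\<^sub>F N in sequentially.
      (\<Sum>k=1..N. Psi (min 1 (1 / (real k * x)))) - real n * Psi 1 = (\<Sum>m<Suc N. T m)"
    by (auto simp: eventually_sequentially intro!: exI[of _ n])
  moreover have "(\<lambda>N. (\<Sum>k=1..N. Psi (min 1 (1 / (real k * x)))) - real n * Psi 1) \<longlonglongrightarrow> L - real n * Psi 1"
    unfolding L_def by (intro tendsto_intros ph_eq_floor_integral(1) x01)
  ultimately have "(\<lambda>N. \<Sum>m<Suc N. T m) \<longlonglongrightarrow> L - real n * Psi 1"
    by (rule Lim_transform_eventually[rotated])
  then have sums: "T sums (L - real n * Psi 1)"
    unfolding sums_def by (rule LIMSEQ_imp_Suc)
  then show "summable (\<lambda>m. if m \<ge> n + 1 then Psi (1 / (real m * x)) else 0)"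
    by (simp add: T_def[abs_def] sums_iff)
  have "L = real n * Psi 1 + (\<Sum>m. T m)"
    using sums by (simp add: sums_iff)
  then show "ph x = lm * ((real n + 1/2) * Psi 1 - Phi1 / x
           + (\<Sum>m. if m \<ge> n + 1 then Psi (1 / (real m * x)) else 0))"
    using ph_eq_floor_integral(2)[OF x01] by (simp add: L_def T_def[abs_def] algebra_simps)
qed

text \<open>Up to the factor \<open>- 1 / x\<^sup>2\<close> this is the derivative of the summand in
  \<open>ph_expansion\<close>. The cut-off is frozen at \<open>n + 1\<close> instead of following
  \<open>1 / x\<close>, so that the series stays continuous up to both endpoints; at
  \<open>x = 1 / (n + 1)\<close> it keeps the term \<open>m = n + 1\<close>, as the right-hand limit
  requires.\<close>

definition dseries :: "nat \<Rightarrow> nat \<Rightarrow> real \<Rightarrow> real" where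
  "dseries n m x = (if m \<ge> n + 1 then ph (1 / (real m * x)) / real m else 0)"

lemma reciprocal_in_unit:
  assumes "m \<ge> n + 1" "1 / real (n + 1) \<le> x"
  shows "0 < 1 / (real m * x)" "1 / (real m * x) \<le> real (n + 1) / real m" "1 / (real m * x) \<le> 1"
proof -
  have x: "0 < x"
    using assms(2) by (rule less_le_trans[rotated]) simp
  then show "0 < 1 / (real m * x)"
    using assms by simp
  show *: "1 / (real m * x) \<le> real (n + 1) / real m"
    using assms x by (simp add: field_simps)
  have "real (n + 1) / real m \<le> 1"
    using assms by simp
  with * show "1 / (real m * x) \<le> 1" by linarith
qed

text \<open>Since \<open>1 / (m * x) \<le> (n + 1) / m\<close>, the decay of \<open>ph\<close> gives
  a multiple of \<open>m powr (-3/2)\<close>, one summable majorant for all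
  \<open>x \<ge> 1 / (n + 1)\<close>.\<close>

lemma dseries_bound:
  obtains M where "summable M"
    "\<And>m x. 1 / real (n + 1) \<le> x \<Longrightarrow> norm (dseries n m x) \<le> M m"
proof -
  obtain C where C: "0 \<le> C" "\<And>x. x \<in> {0..1} \<Longrightarrow> \<bar>ph x\<bar> \<le> C * sqrt x"
    using ph_decay by blast
  show ?thesis
  proof
    show "summable (\<lambda>m. C * sqrt (real (n + 1)) * real m powr (-3/2))"
      by (intro summable_mult) (simp add: summable_real_powr_iff)
    show "norm (dseries n m x) \<le> C * sqrt (real (n + 1)) * real m powr (-3/2)"
      if x: "1 / real (n + 1) \<le> x" for m x
    proof (cases "m \<ge> n + 1")
      case True
      note r = reciprocal_in_unit[OF True x]
      have m: "0 < real m" using True by simp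
      have "\<bar>ph (1 / (real m * x))\<bar> \<le> C * sqrt (1 / (real m * x))"
        using r by (intro C) auto
      also have "\<dots> \<le> C * sqrt (real (n + 1) / real m)"
        using r C by (intro mult_left_mono real_sqrt_le_mono) auto
      finally have "norm (dseries n m x) \<le> C * sqrt (real (n + 1) / real m) / real m"
        using True by (simp add: dseries_def divide_right_mono)
      also have "\<dots> = C * sqrt (real (n + 1)) * (1 / (sqrt (real m) * real m))"
        by (simp add: real_sqrt_divide)
      also have "sqrt (real m) * real m = real m powr (3/2)"
        using m powr_add[of "real m" "1/2" 1] by (simp add: powr_half_sqrt)
      also have "1 / real m powr (3/2) = real m powr (-3/2)"
        using powr_minus_divide[of "real m" "3/2"] by simp
      finally show ?thesis .
    qed (use C in \<open>auto simp: dseries_def\<close>)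
  qed
qed

lemma summable_dseries: "1 / real (n + 1) \<le> x \<Longrightarrow> summable (\<lambda>m. dseries n m x)"
  using dseries_bound[of n] by (metis summable_comparison_test')

text \<open>Uniform convergence by the Weierstrass test. Including the left endpoint is what later
  yields the one-sided limits.\<close>

lemma continuous_on_suminf_dseries:
  "continuous_on {1 / real (n + 1)..} (\<lambda>x. \<Sum>m. dseries n m x)"
proof -
  obtain M where M: "summable M"
    "\<And>m x. 1 / real (n + 1) \<le> x \<Longrightarrow> norm (dseries n m x) \<le> M m"
    using dseries_bound[of n] by blast
  have "continuous_on {1 / real (n + 1)..} (dseries n m)" for m
  proof (cases "m \<ge> n + 1")
    case True
    have "continuous_on {1 / real (n + 1)..} (\<lambda>x. ph (1 / (real m * x)))"
    proof (rule continuous_on_compose2[OF continuous_on_ph])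
      show "continuous_on {1 / real (n + 1)..} (\<lambda>x. 1 / (real m * x))"
        using True reciprocal_in_unit(1)[OF True] by (intro continuous_intros) fastforce
      show "(\<lambda>x. 1 / (real m * x)) ` {1 / real (n + 1)..} \<subseteq> {0..1}"
        using reciprocal_in_unit[OF True] by (force intro: less_imp_le)
    qed
    then show ?thesis
      using True by (auto simp: dseries_def[abs_def] intro!: continuous_intros)
  qed (simp add: dseries_def[abs_def])
  then show ?thesis
    by (intro uniform_limit_theorem[OF _ Weierstrass_m_test[OF M(2) M(1)]])
       (auto intro!: continuous_intros always_eventually)
qed

text \<open>Termwise differentiation of \<open>ph_expansion\<close>: the derived series converges
  uniformly on the open interval, where \<open>1 / t\<^sup>2 \<le> (n + 1)\<^sup>2\<close>, and the
  original series converges at \<open>x\<close>.\<close>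

lemma ph_has_real_derivative:
  fixes n :: nat
  assumes n: "n \<ge> 1" and x: "1 / real (n + 1) < x" "x < 1 / real n"
  shows "(ph has_real_derivative lm / x\<^sup>2 * (Phi1 - (\<Sum>m. dseries n m x))) (at x)"
proof -
  define S where "S = {1 / real (n + 1)<..<1 / real n}"
  obtain M where M: "summable M"
    "\<And>m x. 1 / real (n + 1) \<le> x \<Longrightarrow> norm (dseries n m x) \<le> M m"
    using dseries_bound[of n] by blast
  have pos: "0 < t" if "t \<in> S" for t
    using that unfolding S_def by (auto intro: less_trans[rotated])
  have der: "((\<lambda>x. if m \<ge> n + 1 then Psi (1 / (real m * x)) else 0)
      has_real_derivative - (dseries n m t / t\<^sup>2)) (at t within S)" if t: "t \<in> S" for m t
  proof (cases "m \<ge> n + 1")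
    case True
    have m: "real m > 0" using True by simp
    \<comment> \<open>Strictness keeps \<open>1 / (m * t)\<close> inside the open unit interval,
      where \<open>Psi\<close> is known to be differentiable.\<close>
    have "1 < real (n + 1) * t" using t by (simp add: S_def field_simps)
    also have "\<dots> \<le> real m * t" using True pos[OF t] by (intro mult_right_mono) auto
    finally have lt: "1 / (real m * t) < 1" by simp
    have "((\<lambda>x. 1 / (real m * x)) has_real_derivative - (1 / (real m * t\<^sup>2))) (at t)"
      using m pos[OF t] by (auto intro!: derivative_eq_intros simp: field_simps power2_eq_square)
    from DERIV_chain2[OF Psi_has_real_derivative this] lt m pos[OF t] True
    show ?thesis
      by (auto simp: dseries_def intro: has_field_derivative_at_within)
  qed (simp add: dseries_def)
  have le: "norm (- (dseries n m t / t\<^sup>2)) \<le> (real (n + 1))\<^sup>2 * M m" if t: "t \<in> S" for m t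
  proof -
    have "1 / t\<^sup>2 \<le> (real (n + 1))\<^sup>2"
    proof -
      have "1 / t \<le> real (n + 1)"
        using t pos[OF t] by (simp add: S_def field_simps)
      then have "(1 / t)\<^sup>2 \<le> (real (n + 1))\<^sup>2"
        using pos[OF t] by (intro power_mono) auto
      then show ?thesis by (simp add: power_divide)
    qed
    then have "1 / t\<^sup>2 * norm (dseries n m t) \<le> (real (n + 1))\<^sup>2 * M m"
      using t by (intro mult_mono M(2)) (auto simp: S_def)
    then show ?thesis by simp
  qed
  have unif: "uniformly_convergent_on S (\<lambda>N t. \<Sum>m<N. - (dseries n m t / t\<^sup>2))"
    by (rule Weierstrass_m_test'[OF le summable_mult[OF M(1)]])
  have xS: "x \<in> S" using x by (simp add: S_def)
  then have xi: "x \<in> interior S" by (simp add: S_def interior_open)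
  have "((\<lambda>x. \<Sum>m. if m \<ge> n + 1 then Psi (1 / (real m * x)) else 0)
      has_real_derivative (\<Sum>m. - (dseries n m x / x\<^sup>2))) (at x)"
    by (rule has_field_derivative_series'(2)[OF _ der unif xS ph_expansion(1)[OF n x] xi])
       (simp add: S_def)
  also have "(\<Sum>m. - (dseries n m x / x\<^sup>2)) = - ((\<Sum>m. dseries n m x) / x\<^sup>2)"
    using summable_dseries[of n x] x
    by (simp add: suminf_minus suminf_divide summable_divide)
  finally have "((\<lambda>x. lm * ((real n + 1/2) * Psi 1 - Phi1 / x
           + (\<Sum>m. if m \<ge> n + 1 then Psi (1 / (real m * x)) else 0))) has_real_derivative
      lm * (0 - (- (Phi1 / x\<^sup>2)) + - ((\<Sum>m. dseries n m x) / x\<^sup>2))) (at x)"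
    using pos[OF xS]
    by (intro DERIV_cmult DERIV_add DERIV_diff DERIV_const)
       (auto intro!: derivative_eq_intros simp: power2_eq_square)
  then have "(ph has_real_derivative
      lm * (0 - (- (Phi1 / x\<^sup>2)) + - ((\<Sum>m. dseries n m x) / x\<^sup>2))) (at x)"
    by (rule has_field_derivative_transform_within_open[of _ _ _ S])
       (use xS ph_expansion(2)[OF n] in \<open>auto simp: S_def\<close>)
  then show ?thesis
    by (simp add: right_diff_distrib diff_divide_distrib)
qed

end

section \<open>The derivative formula and its one-sided limits\<close>

theorem theorem4p1:
  fixes phis :: "nat \<Rightarrow> real \<Rightarrow> real" and lams :: "nat \<Rightarrow> real" and j :: nat
  assumes sys: "eigen_system phis lams" and j: "j \<ge> 1"
  defines "ph \<equiv> phis j" and "lm \<equiv> lams j"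
  defines "Phi1 \<equiv> (LINT y:{0..1}|lebesgue. ph y / y)"
  shows "set_integrable lebesgue {0..1} (\<lambda>y. ph y / y)
    \<and> (\<forall>x. 0 < x \<and> x < 1 \<and> 1 / x \<notin> \<int> \<longrightarrow>
          ph differentiable (at x)
          \<and> summable (\<lambda>m::nat. if real m > 1 / x then ph (1 / (real m * x)) / real m else 0)
          \<and> inverse lm * x\<^sup>2 * deriv ph x
              = Phi1 - (\<Sum>m. if real m > 1 / x then ph (1 / (real m * x)) / real m else 0))
    \<and> (\<forall>n::nat. n \<ge> 1 \<longrightarrow>
          continuous_on {1 / real (n + 1)<..<1 / real n} (deriv ph)
          \<and> summable (\<lambda>m::nat. if m \<ge> n + 1 then ph (real n / real m) / real m else 0)
          \<and> summable (\<lambda>m::nat. if m \<ge> n + 1 then ph (real (n + 1) / real m) / real m else 0)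
          \<and> (deriv ph \<longlongrightarrow> lm * (real n)\<^sup>2 * (Phi1 -
               (\<Sum>m. if m \<ge> n + 1 then ph (real n / real m) / real m else 0)))
              (at_left (1 / real n))
          \<and> (deriv ph \<longlongrightarrow> lm * (real (n + 1))\<^sup>2 * (Phi1 -
               (\<Sum>m. if m \<ge> n + 1 then ph (real (n + 1) / real m) / real m else 0)))
              (at_right (1 / real (n + 1))))"
proof -
  have "lm \<noteq> 0" and "eigenfun ph lm"
    using sys j by (auto simp: eigen_system_def ph_def lm_def)
  then interpret kerK_eigenfunction ph lm
    by unfold_locales (auto simp: eigenfun_def)
  have Phi1_eq: "Phi1 = kerK_eigenfunction.Phi1 ph"
    by (simp add: assms(5) Phi1_def)
  \<comment> \<open>The derivative on the \<open>n\<close>-th open interval, by a formula that is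
    continuous on the closed one; its endpoint values are the required limits.\<close>
  define G where "G n x = lm / x\<^sup>2 * (Phi1 - (\<Sum>m. dseries n m x))" for n x
  have der: "(ph has_real_derivative G n x) (at x)"
    if "n \<ge> 1" "1 / real (n + 1) < x" "x < 1 / real n" for n x
    unfolding G_def Phi1_eq using that by (rule ph_has_real_derivative)
  have deriv_eq: "deriv ph x = G n x"
    if "n \<ge> 1" "x \<in> {1 / real (n + 1)<..<1 / real n}" for n x
    using der[of n x] that by (auto intro: DERIV_imp_deriv)
  have contG: "continuous_on {1 / real (n + 1)..1 / real n} (G n)" for n
  proof -
    have "x \<noteq> 0" if "1 / real (n + 1) \<le> x" for x
      using that by (auto simp: not_le)
    then show ?thesis
      unfolding G_def
      by (intro continuous_intros continuous_on_subset[OF continuous_on_suminf_dseries]) auto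
  qed
  have part2: "ph differentiable (at x)
      \<and> summable (\<lambda>m::nat. if real m > 1 / x then ph (1 / (real m * x)) / real m else 0)
      \<and> inverse lm * x\<^sup>2 * deriv ph x
          = Phi1 - (\<Sum>m. if real m > 1 / x then ph (1 / (real m * x)) / real m else 0)"
    if x: "0 < x" "x < 1" "1 / x \<notin> \<int>" for x
  proof -
    define n where "n = nat \<lfloor>1 / x\<rfloor>"
    have "1 < 1 / x"
      using x by simp
    then have "1 \<le> \<lfloor>1 / x\<rfloor>"
      by linarith
    then have n: "n \<ge> 1" and n_eq: "real n = of_int \<lfloor>1 / x\<rfloor>"
      unfolding n_def by linarith+
    \<comment> \<open>Non-integrality of \<open>1 / x\<close> puts \<open>x\<close> strictly inside
      the \<open>n\<close>-th interval, and then \<open>m > 1 / x\<close> means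
      \<open>m \<ge> n + 1\<close>.\<close>
    have "real n \<noteq> 1 / x"
      using x(3) n_eq by (metis Ints_of_int)
    then have lt: "real n < 1 / x" "1 / x < real (n + 1)"
      using n_eq by linarith+
    have xn: "1 / real (n + 1) < x" "x < 1 / real n"
      using lt x n by (auto simp: field_simps)
    have "real m > 1 / x \<longleftrightarrow> m \<ge> n + 1" for m
      using lt by (auto dest: less_trans)
    then have ds: "(\<lambda>m. if real m > 1 / x then ph (1 / (real m * x)) / real m else 0) = (\<lambda>m. dseries n m x)"
      by (auto simp: dseries_def)
    have "deriv ph x = G n x"
      using n xn by (intro deriv_eq) auto
    then have "inverse lm * x\<^sup>2 * deriv ph x = Phi1 - (\<Sum>m. dseries n m x)"
      using \<open>lm \<noteq> 0\<close> x by (simp add: G_def field_simps)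
    then show ?thesis
      unfolding ds using der[OF n xn] summable_dseries[of n x] xn
      by (auto simp: real_differentiable_def)
  qed
  have part3: "continuous_on {1 / real (n + 1)<..<1 / real n} (deriv ph)
      \<and> summable (\<lambda>m::nat. if m \<ge> n + 1 then ph (real n / real m) / real m else 0)
      \<and> summable (\<lambda>m::nat. if m \<ge> n + 1 then ph (real (n + 1) / real m) / real m else 0)
      \<and> (deriv ph \<longlongrightarrow> lm * (real n)\<^sup>2 * (Phi1 -
           (\<Sum>m. if m \<ge> n + 1 then ph (real n / real m) / real m else 0)))
          (at_left (1 / real n))
      \<and> (deriv ph \<longlongrightarrow> lm * (real (n + 1))\<^sup>2 * (Phi1 -
           (\<Sum>m. if m \<ge> n + 1 then ph (real (n + 1) / real m) / real m else 0)))
          (at_right (1 / real (n + 1)))" if n: "n \<ge> 1" for n :: nat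
  proof -
    let ?a = "1 / real (n + 1)" and ?b = "1 / real n"
    have ab: "?a < ?b"
      using n by (simp add: field_simps)
    have ds_b: "(\<lambda>m. if m \<ge> n + 1 then ph (real n / real m) / real m else 0) = (\<lambda>m. dseries n m ?b)"
      and ds_a: "(\<lambda>m. if m \<ge> n + 1 then ph (real (n + 1) / real m) / real m else 0) = (\<lambda>m. dseries n m ?a)"
      by (auto simp: dseries_def)
    have "continuous_on {?a<..<?b} (G n)"
      by (rule continuous_on_subset[OF contG]) auto
    then have cont: "continuous_on {?a<..<?b} (deriv ph)"
      by (rule continuous_on_eq) (simp only: deriv_eq[OF n])
    have "(G n \<longlongrightarrow> G n ?b) (at_left ?b)"
      by (rule continuous_on_Icc_at_leftD[OF contG ab])
    \<comment> \<open>The one-sided filter only sees the open interval, where \<open>G n\<close>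
      agrees with \<open>deriv ph\<close>; nothing is claimed about \<open>deriv ph\<close> at the
      endpoint.\<close>
    moreover have "\<forall>\<^sub>F x in at_left ?b. G n x = deriv ph x"
      using eventually_at_left_real[OF ab] by eventually_elim (simp only: deriv_eq[OF n])
    ultimately have left: "(deriv ph \<longlongrightarrow> G n ?b) (at_left ?b)"
      by (rule Lim_transform_eventually)
    have "(G n \<longlongrightarrow> G n ?a) (at_right ?a)"
      by (rule continuous_on_Icc_at_rightD[OF contG ab])
    moreover have "\<forall>\<^sub>F x in at_right ?a. G n x = deriv ph x"
      using eventually_at_right_real[OF ab] by eventually_elim (simp only: deriv_eq[OF n])
    ultimately have right: "(deriv ph \<longlongrightarrow> G n ?a) (at_right ?a)"
      by (rule Lim_transform_eventually)
    have "G n ?b = lm * (real n)\<^sup>2 * (Phi1 - (\<Sum>m. dseries n m ?b))"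
      and "G n ?a = lm * (real (n + 1))\<^sup>2 * (Phi1 - (\<Sum>m. dseries n m ?a))"
      by (simp_all add: G_def power_one_over)
    then show ?thesis
      unfolding ds_a ds_b using cont left right summable_dseries[of n ?a] summable_dseries[of n ?b] ab
      by simp
  qed
  show ?thesis
    by (rule conjI[OF set_integrable_ph_divide conjI]; rule allI, rule impI;
        (elim conjE)?, (rule part2 part3; assumption))
qed

end
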